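(* Consider the SLTIS (L). Assume that there exists a positive semidefinite matrix $Q\in\mathbb{R}^{d\times d}$ such that $\ker(Q)\subseteq\ker(A)\cap\ker(C)\cap\big(\bigcap_{j=1}^k\ker(\mathfrak{A}(j))\big)$ and $\mathfrak{M}_Q\le0$ (negative semidefinite). Then the SLTIS (L) is an SLTI-PHS with $Q$.
   Context: Let $d,n,k\in\mathbb{N}$ and let $A\in\mathbb{R}^{d\times d}$, $B\in\mathbb{R}^{d\times n}$, $C\in\mathbb{R}^{n\times d}$, $D\in\mathbb{R}^{n\times n}$, $\mathfrak{A}(j)\in\mathbb{R}^{d\times d}$, $\mathfrak{B}(j)\in\mathbb{R}^{d\times n}$, $j=1,\dots,k$. The stochastic, linear, time-invariant input-state-output system (SLTIS) (L) is $$dX_t=(AX_t+Bu_t)dt+\sum_{j=1}^k(\mathfrak{A}(j)X_t+\mathfrak{B}(j)u_t)dW_t^j,\quad Y_t=CX_t+Du_t,\quad X_0=x_0\in\mathbb{R}^d,\quad u\in\mathcal{A},$$ with an $\mathbb{R}^k$-valued Wiener process $W$ and a set $\mathcal{A}$ of $\mathbb{R}^n$-valued progressively measurable controls; its coefficients are $b(x,v)=Ax+Bv$, $\sigma^j(x,v)=\mathfrak{A}(j)x+\mathfrak{B}(j)v$, $f(x,v)=Cx+Dv$. For symmetric $Q\in\mathbb{R}^{d\times d}$ (positive semidefinite $Q$ are understood to be symmetric) define $$\mathfrak{M}_Q:=\begin{pmatrix}QA+A^\top Q+\sum_{j=1}^k\mathfrak{A}^\top(j)Q\mathfrak{A}(j)&QB-C^\top+\sum_{j=1}^k\mathfrak{A}^\top(j)Q\mathfrak{B}(j)\\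 B^\top Q-C+\sum_{j=1}^k\mathfrak{B}^\top(j)Q\mathfrak{A}(j)&-(D+D^\top)+\sum_{j=1}^k\mathfrak{B}^\top(j)Q\mathfrak{B}(j)\end{pmatrix}.$$ Definition (SLTI-PHS). A system with coefficients $b,\sigma,f$ is a stochastic, linear, time-invariant port-Hamiltonian system with $Q$ (SLTI-PHS with $Q$) if $Q=Q^\top\ge0$ and there exist $J,R,\overline{\mathfrak{A}}(j)\in\mathbb{R}^{d\times d}$, $F,P,\mathfrak{B}(j)\in\mathbb{R}^{d\times n}$ ($j=1,\dots,k$), $S,N\in\mathbb{R}^{n\times n}$ such that $J=-J^\top$, $R=R^\top$, $S=S^\top$, $N=-N^\top$, $$\begin{pmatrix}R&P\\P^\top&S\end{pmatrix}\ge0,$$ and for all $x\in\mathbb{R}^d$, $v\in\mathbb{R}^n$, $i\in\{1,\dots,k\}$ $$b(x,v)=\Big(J-R-\tfrac12\sum_{j=1}^k\overline{\mathfrak{A}}^\top(j)Q\overline{\mathfrak{A}}(j)\Big)Qx+(F-P)v,\qquad \sigma^i(x,v)=\overline{\mathfrak{A}}(i)Qx+\mathfrak{B}(i)v,$$ $$f(x,v)=\Big(F+P+\sum_{j=1}^k\overline{\mathfrak{A}}^\top(j)Q\mathfrak{B}(j)\Big)^\top Qx+\Big(S+N+\tfrac12\sum_{j=1}^k\mathfrak{B}^\top(j)Q\mathfrak{B}(j)\Big)v.$$ *)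

theory Defs
  imports "HOL-Analysis.Analysis"
begin

text \<open>
  A real \<open>m \<times> p\<close> matrix has type \<^typ>\<open>real^'p^'m\<close>, so \<open>\<real>\<^sup>d\<close> and \<open>\<real>\<^sup>n\<close> are indexed by finite types
  \<open>'d\<close> and \<open>'n\<close>. The number \<open>k\<close> of driving Brownian motions is a natural number, and noise
  channels are indexed by \<open>1, \<dots>, k\<close>; values of \<open>nat\<close>-indexed families outside this range are
  never used.
\<close>

definition mat_kernel :: "real^'p^'m \<Rightarrow> (real^'p) set" where
  "mat_kernel M = {x. M *v x = 0}"

definition pos_semidef :: "real^'m^'m \<Rightarrow> bool" where
  "pos_semidef M \<longleftrightarrow> transpose M = M \<and> (\<forall>x. 0 \<le> x \<bullet> (M *v x))"

definition neg_semidef :: "real^'m^'m \<Rightarrow> bool" where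
  "neg_semidef M \<longleftrightarrow> transpose M = M \<and> (\<forall>x. x \<bullet> (M *v x) \<le> 0)"

definition block_mat ::
  "real^'d^'d \<Rightarrow> real^'n^'d \<Rightarrow> real^'d^'n \<Rightarrow> real^'n^'n \<Rightarrow> real^('d + 'n)^('d + 'n)" where
  "block_mat M11 M12 M21 M22 = (\<chi> i j. case (i, j) of
      (Inl a, Inl b) \<Rightarrow> M11 $ a $ b
    | (Inl a, Inr b) \<Rightarrow> M12 $ a $ b
    | (Inr a, Inl b) \<Rightarrow> M21 $ a $ b
    | (Inr a, Inr b) \<Rightarrow> M22 $ a $ b)"

text \<open>
  The stochastic control system
  \<open>dX = drift X u dt + (\<Sum>j = 1..noise_dim. diffusion j X u dW\<^sup>j)\<close>, \<open>Y = readout X u\<close> enters only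
  through its coefficients \<open>b\<close>, \<open>\<sigma>\<^sup>j\<close>, \<open>f\<close>: being port-Hamiltonian is a property of these alone,
  whatever the Wiener process, the initial value and the class of admissible controls.
\<close>

record ('d, 'n) control_system =
  noise_dim :: nat
  drift :: "real^'d \<Rightarrow> real^'n \<Rightarrow> real^'d"
  diffusion :: "nat \<Rightarrow> real^'d \<Rightarrow> real^'n \<Rightarrow> real^'d"
  readout :: "real^'d \<Rightarrow> real^'n \<Rightarrow> real^'n"

definition sltis ::
  "nat \<Rightarrow> real^'d^'d \<Rightarrow> real^'n^'d \<Rightarrow> real^'d^'n \<Rightarrow> real^'n^'n \<Rightarrow>
   (nat \<Rightarrow> real^'d^'d) \<Rightarrow> (nat \<Rightarrow> real^'n^'d) \<Rightarrow> ('d::finite, 'n::finite) control_system" where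
  "sltis k A B C D \<AA> \<BB> =
    \<lparr> noise_dim = k,
      drift = (\<lambda>x v. A *v x + B *v v),
      diffusion = (\<lambda>j x v. \<AA> j *v x + \<BB> j *v v),
      readout = (\<lambda>x v. C *v x + D *v v) \<rparr>"

definition lmi_mat ::
  "nat \<Rightarrow> real^'d^'d \<Rightarrow> real^'n^'d \<Rightarrow> real^'d^'n \<Rightarrow> real^'n^'n \<Rightarrow>
   (nat \<Rightarrow> real^'d^'d) \<Rightarrow> (nat \<Rightarrow> real^'n^'d) \<Rightarrow> real^'d^'d \<Rightarrow> real^('d + 'n)^('d + 'n)" where
  "lmi_mat k A B C D \<AA> \<BB> Q = block_mat
     (Q ** A + transpose A ** Q + (\<Sum>j=1..k. transpose (\<AA> j) ** Q ** \<AA> j))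
     (Q ** B - transpose C + (\<Sum>j=1..k. transpose (\<AA> j) ** Q ** \<BB> j))
     (transpose B ** Q - C + (\<Sum>j=1..k. transpose (\<BB> j) ** Q ** \<AA> j))
     (- (D + transpose D) + (\<Sum>j=1..k. transpose (\<BB> j) ** Q ** \<BB> j))"

definition slti_phs ::
  "('d::finite, 'n::finite) control_system \<Rightarrow> real^'d^'d \<Rightarrow> bool" where
  "slti_phs \<Sigma> Q \<longleftrightarrow> pos_semidef Q \<and>
     (\<exists>(J :: real^'d^'d) (R :: real^'d^'d) (\<AA>' :: nat \<Rightarrow> real^'d^'d)
       (F :: real^'n^'d) (P :: real^'n^'d) (\<BB> :: nat \<Rightarrow> real^'n^'d)
       (S :: real^'n^'n) (N :: real^'n^'n).
        J = - transpose J \<and> R = transpose R \<and> S = transpose S \<and> N = - transpose N \<and>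
        pos_semidef (block_mat R P (transpose P) S) \<and>
        (\<forall>x v. drift \<Sigma> x v =
           ((J - R - (1/2) *\<^sub>R (\<Sum>j=1..noise_dim \<Sigma>. transpose (\<AA>' j) ** Q ** \<AA>' j)) ** Q) *v x
           + (F - P) *v v) \<and>
        (\<forall>x v. \<forall>i\<in>{1..noise_dim \<Sigma>}. diffusion \<Sigma> i x v = (\<AA>' i ** Q) *v x + \<BB> i *v v) \<and>
        (\<forall>x v. readout \<Sigma> x v =
           (transpose (F + P + (\<Sum>j=1..noise_dim \<Sigma>. transpose (\<AA>' j) ** Q ** \<BB> j)) ** Q) *v x
           + (S + N + (1/2) *\<^sub>R (\<Sum>j=1..noise_dim \<Sigma>. transpose (\<BB> j) ** Q ** \<BB> j)) *v v))"

end

theory Submission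
  imports Defs
begin

text \<open>
  Since \<open>Q\<close> may be singular, its inverse is replaced by a symmetric generalized inverse \<open>G\<close>,
  \<open>Q G Q = Q\<close>; the kernel condition gives \<open>A G Q = A\<close>, \<open>C G Q = C\<close> and \<open>\<AA> j G Q = \<AA> j\<close>.
  The matrices \<open>J - R - \<dots>\<close> and \<open>F\<close> are determined only up to terms annihilated by \<open>Q\<close>, and this
  freedom is used to make the block matrix of \<open>R, P, S\<close> equal to
  \<open>- 1/2 diag(G, I) \<MM>\<^sub>Q diag(G, I)\<close>, which is positive semidefinite.
\<close>

lemma transpose_add: "transpose (X + Y) = transpose X + transpose (Y :: 'a::ab_group_add^'m^'p)"
  by (simp add: transpose_def vec_eq_iff)

lemma transpose_diff: "transpose (X - Y) = transpose X - transpose (Y :: 'a::ab_group_add^'m^'p)"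
  by (simp add: transpose_def vec_eq_iff)

lemma transpose_minus: "transpose (- X) = - transpose (X :: 'a::ab_group_add^'m^'p)"
  by (simp add: transpose_def vec_eq_iff)

lemma transpose_sum:
  "transpose (\<Sum>j\<in>I. f j) = (\<Sum>j\<in>I. transpose (f j :: 'a::ab_group_add^'m^'p))"
  by (simp add: transpose_def vec_eq_iff)

lemma matrix_add_rdistrib: "(X + Y) ** Z = X ** Z + Y ** (Z :: real^'m^'p)"
  by (simp add: matrix_matrix_mult_def vec_eq_iff distrib_right sum.distrib)

lemma matrix_mult_diff_left: "(X - Y) ** Z = X ** Z - Y ** (Z :: real^'m^'p)"
  by (simp add: matrix_matrix_mult_def vec_eq_iff left_diff_distrib sum_subtractf)

lemma matrix_mult_diff_right: "Z ** (X - Y) = Z ** X - Z ** (Y :: real^'m^'p)"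
  by (simp add: matrix_matrix_mult_def vec_eq_iff right_diff_distrib sum_subtractf)

lemma matrix_mult_sum_left: "(\<Sum>j\<in>I. f j) ** Z = (\<Sum>j\<in>I. f j ** (Z :: real^'m^'p))"
  by (induction I rule: infinite_finite_induct)
    (simp_all add: matrix_add_rdistrib)

lemma matrix_mult_sum_right: "Z ** (\<Sum>j\<in>I. f j) = (\<Sum>j\<in>I. Z ** (f j :: real^'m^'p))"
  by (induction I rule: infinite_finite_induct)
    (simp_all add: matrix_add_ldistrib)

text \<open>As simp rules these push transposes down to the factors, multiply out and associate to
  the left, so that a matrix identity becomes a comparison of sums of left-nested products.\<close>

lemmas matrix_algebra = transpose_add transpose_diff transpose_minus transpose_sum
  transpose_scalar matrix_transpose_mul matrix_add_ldistrib matrix_add_rdistrib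
  matrix_mult_diff_left matrix_mult_diff_right matrix_mult_sum_left matrix_mult_sum_right
  matrix_mul_assoc

text \<open>A linear right inverse of \<open>Q\<close> on its range gives some \<open>H\<close> with
  \<open>Q ** H ** Q = Q\<close>. Transposing this equation shows that \<open>transpose H\<close>
  solves it too, and so does the symmetric average of both.\<close>

lemma symmetric_generalized_inverse:
  fixes Q :: "real^'d^'d"
  assumes "transpose Q = Q"
  obtains G :: "real^'d^'d" where "transpose G = G" "Q ** G ** Q = Q"
proof -
  obtain g where g: "linear g" "\<And>v. Q *v (g (Q *v v)) = Q *v v"
    using linear_exists_right_inverse_on[of "(*v) Q" UNIV] by auto
  define H where "H = matrix g"
  have H: "Q ** H ** Q = Q"
    using g by (simp add: matrix_eq H_def flip: matrix_vector_mul_assoc)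
  have H': "Q ** transpose H ** Q = Q"
    using arg_cong[OF H, of transpose] assms by (simp add: matrix_algebra)
  let ?G = "(1/2) *\<^sub>R (H + transpose H)"
  have "Q ** ?G ** Q = (1/2) *\<^sub>R (Q ** H ** Q + Q ** transpose H ** Q)"
    by (simp add: matrix_algebra matrix_scalar_ac scaleR_add_right flip: scalar_matrix_assoc)
  also have "\<dots> = Q"
    by (simp add: H H' flip: scaleR_2)
  finally show ?thesis
    by (intro that[of ?G]) (simp_all add: matrix_algebra add.commute)
qed

text \<open>Each vector \<open>x - (G ** Q) *v x\<close> is annihilated by \<open>Q\<close>, hence
  also by \<open>M\<close>.\<close>

lemma generalized_inverse_absorb:
  fixes Q G :: "real^'d^'d" and M :: "real^'d^'m"
  assumes "Q ** G ** Q = Q" "mat_kernel Q \<subseteq> mat_kernel M"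
  shows "M ** G ** Q = M"
proof -
  have "M *v (x - (G ** Q) *v x) = 0" for x
  proof -
    have "Q *v (x - (G ** Q) *v x) = 0"
      using assms(1) by (simp add: matrix_vector_mult_diff_distrib matrix_vector_mul_assoc matrix_mul_assoc)
    with assms(2) show ?thesis
      by (auto simp: mat_kernel_def)
  qed
  then show ?thesis
    by (simp add: matrix_eq matrix_vector_mult_diff_distrib matrix_vector_mul_assoc matrix_mul_assoc)
qed

lemma block_mat_nth [simp]:
  "block_mat M11 M12 M21 M22 $ Inl a $ Inl b = M11 $ a $ b"
  "block_mat M11 M12 M21 M22 $ Inl a $ Inr b' = M12 $ a $ b'"
  "block_mat M11 M12 M21 M22 $ Inr a' $ Inl b = M21 $ a' $ b"
  "block_mat M11 M12 M21 M22 $ Inr a' $ Inr b' = M22 $ a' $ b'"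
  by (simp_all add: block_mat_def)

lemma all_sum_type: "(\<forall>i :: 'a + 'b. P i) \<longleftrightarrow> (\<forall>a. P (Inl a)) \<and> (\<forall>b. P (Inr b))"
  by (metis sum.exhaust)

lemma block_mat_eq_iff:
  "block_mat M11 M12 M21 M22 = block_mat N11 N12 N21 N22 \<longleftrightarrow>
    M11 = N11 \<and> M12 = N12 \<and> M21 = N21 \<and> M22 = N22"
  by (auto simp: vec_eq_iff all_sum_type)

lemma transpose_block_mat:
  "transpose (block_mat M11 M12 M21 M22) =
    block_mat (transpose M11) (transpose M21) (transpose M12) (transpose M22)"
  by (simp add: vec_eq_iff all_sum_type transpose_def)

lemma sum_UNIV_sum_type:
  fixes f :: "'a::finite + 'b::finite \<Rightarrow> real"
  shows "(\<Sum>i\<in>UNIV. f i) = (\<Sum>a\<in>UNIV. f (Inl a)) + (\<Sum>b\<in>UNIV. f (Inr b))"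
  by (simp add: UNIV_Plus_UNIV[symmetric] sum.Plus del: UNIV_Plus_UNIV)

lemma block_mat_quadratic_form:
  fixes x :: "real^('d::finite + 'n::finite)"
  defines "u \<equiv> \<chi> i. x $ Inl i" and "w \<equiv> \<chi> i. x $ Inr i"
  shows "x \<bullet> (block_mat M11 M12 M21 M22 *v x) =
    u \<bullet> (M11 *v u) + u \<bullet> (M12 *v w) + w \<bullet> (M21 *v u) + w \<bullet> (M22 *v w)"
  by (simp add: inner_vec_def matrix_vector_mult_def sum_UNIV_sum_type u_def w_def
      distrib_left sum.distrib)

text \<open>The new matrix is \<open>c\<close> times the congruence of the old one by
  diag(\<open>G\<close>, I): its quadratic form at (u, w) is \<open>c\<close> times the old form at
  (\<open>G\<close> u, w), a product of two nonpositive numbers.\<close>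

lemma pos_semidef_block_congruence:
  fixes M11 G :: "real^'d::finite^'d" and M22 :: "real^'n::finite^'n"
  assumes neg: "neg_semidef (block_mat M11 M12 M21 M22)" and G: "transpose G = G"
    and "c \<le> 0"
  shows "pos_semidef (block_mat (c *\<^sub>R (G ** M11 ** G)) (c *\<^sub>R (G ** M12))
    (transpose (c *\<^sub>R (G ** M12))) (c *\<^sub>R M22))"
    (is "pos_semidef ?N")
proof -
  have sym: "transpose M11 = M11" "transpose M12 = M21" "transpose M21 = M12" "transpose M22 = M22"
    using neg by (auto simp: neg_semidef_def transpose_block_mat block_mat_eq_iff)
  have "transpose ?N = ?N"
    by (simp add: transpose_block_mat block_mat_eq_iff matrix_algebra G sym)
  moreover have "0 \<le> x \<bullet> (?N *v x)" for x
  proof -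
    define u :: "real^'d" where "u = (\<chi> i. x $ Inl i)"
    define w :: "real^'n" where "w = (\<chi> i. x $ Inr i)"
    define y :: "real^('d + 'n)" where
      "y = (\<chi> i. case i of Inl a \<Rightarrow> (G *v u) $ a | Inr b \<Rightarrow> w $ b)"
    have y: "(\<chi> i. y $ Inl i) = G *v u" "(\<chi> i. y $ Inr i) = w"
      by (simp_all add: y_def vec_eq_iff)
    have Gu: "u \<bullet> (G *v z) = (G *v u) \<bullet> z" for z
      using G by (metis dot_lmul_matrix vector_transpose_matrix)
    have "x \<bullet> (?N *v x) = c * (y \<bullet> (block_mat M11 M12 M21 M22 *v y))"
      unfolding block_mat_quadratic_form y u_def[symmetric] w_def[symmetric]
      by (simp add: matrix_algebra G sym Gu scaleR_matrix_vector_assoc[symmetric]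
          matrix_vector_mul_assoc[symmetric] distrib_left)
    with neg \<open>c \<le> 0\<close> show ?thesis
      by (simp add: neg_semidef_def mult_nonpos_nonpos)
  qed
  ultimately show ?thesis
    by (simp add: pos_semidef_def)
qed

theorem lemma9p5:
  fixes k :: nat
    and A :: "real^'d^'d" and B :: "real^'n^'d" and C :: "real^'d^'n" and D :: "real^'n^'n"
    and \<AA> :: "nat \<Rightarrow> real^'d^'d" and \<BB> :: "nat \<Rightarrow> real^'n^'d"
    and Q :: "real^'d^'d"
  assumes "pos_semidef Q"
    and "mat_kernel Q \<subseteq> mat_kernel A \<inter> mat_kernel C \<inter> (\<Inter>j\<in>{1..k}. mat_kernel (\<AA> j))"
    and "neg_semidef (lmi_mat k A B C D \<AA> \<BB> Q)"
  shows "slti_phs (sltis k A B C D \<AA> \<BB>) Q"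
proof -
  have Q: "transpose Q = Q"
    using assms(1) by (simp add: pos_semidef_def)
  then obtain G where G: "transpose G = G" and QGQ: "Q ** G ** Q = Q"
    by (rule symmetric_generalized_inverse)
  have AGQ: "A ** G ** Q = A" and CGQ: "C ** G ** Q = C"
    and \<AA>GQ: "\<And>j. j \<in> {1..k} \<Longrightarrow> \<AA> j ** G ** Q = \<AA> j"
    using assms(2) by (auto intro!: generalized_inverse_absorb[OF QGQ])
  define E11 where "E11 = (\<Sum>j=1..k. transpose (\<AA> j) ** Q ** \<AA> j)"
  define E12 where "E12 = (\<Sum>j=1..k. transpose (\<AA> j) ** Q ** \<BB> j)"
  define E21 where "E21 = (\<Sum>j=1..k. transpose (\<BB> j) ** Q ** \<AA> j)"
  define E22 where "E22 = (\<Sum>j=1..k. transpose (\<BB> j) ** Q ** \<BB> j)"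
  define M11 where "M11 = Q ** A + transpose A ** Q + E11"
  define M12 where "M12 = Q ** B - transpose C + E12"
  define M21 where "M21 = transpose B ** Q - C + E21"
  define M22 where "M22 = - (D + transpose D) + E22"
  \<comment> \<open>Absorption turns \<open>\<AA>' j ** Q\<close> back into \<open>\<AA> j\<close>
    for the channels 1 to \<open>k\<close>.\<close>
  define \<AA>' where "\<AA>' j = \<AA> j ** G" for j
  define R where "R = (- 1/2) *\<^sub>R (G ** M11 ** G)"
  define P where "P = (- 1/2) *\<^sub>R (G ** M12)"
  define S where "S = (- 1/2) *\<^sub>R M22"
  \<comment> \<open>\<open>N\<close> is the antisymmetric part of \<open>D\<close>; the symmetric
    part is left to \<open>S\<close> together with the noise term \<open>E22\<close>.\<close>
  define N where "N = (1/2) *\<^sub>R (D - transpose D)"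
  \<comment> \<open>Forced by the input term of the drift, \<open>F - P = B\<close>.\<close>
  define F where "F = B + P"
  \<comment> \<open>The second summand vanishes after multiplication by \<open>Q\<close>; it makes the symmetric part of \<open>K\<close>
    equal to that of \<open>G Q A G\<close>.\<close>
  define K where "K = A ** G - (G ** transpose A - G ** transpose A ** Q ** G)"
  \<comment> \<open>The drift needs a matrix that \<open>Q\<close> multiplies to \<open>A\<close>.
    \<open>K\<close> is such a matrix: \<open>J\<close> is its antisymmetric part, and
    \<open>R\<close> with the noise correction has to supply the symmetric part.\<close>
  define J where "J = (1/2) *\<^sub>R (K - transpose K)"
  have E11': "(\<Sum>j=1..k. transpose (\<AA>' j) ** Q ** \<AA>' j) = G ** E11 ** G"
    by (simp add: \<AA>'_def E11_def matrix_algebra G)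
  have E12': "(\<Sum>j=1..k. transpose (\<AA>' j) ** Q ** \<BB> j) = G ** E12"
    by (simp add: \<AA>'_def E12_def matrix_algebra G)
  have neg: "neg_semidef (block_mat M11 M12 M21 M22)"
    using assms(3) by (simp add: lmi_mat_def M11_def M12_def M21_def M22_def
        E11_def E12_def E21_def E22_def)
  have psd: "pos_semidef (block_mat R P (transpose P) S)"
    unfolding R_def P_def S_def by (rule pos_semidef_block_congruence[OF neg G]) simp
  then have RS: "R = transpose R" "S = transpose S"
    by (auto simp: pos_semidef_def transpose_block_mat block_mat_eq_iff)
  have J: "J = - transpose J" and N: "N = - transpose N"
    by (simp_all add: J_def N_def matrix_algebra flip: scaleR_minus_right)
  \<comment> \<open>The terms \<open>A ** G\<close> and \<open>G ** transpose A\<close> cancel,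
    which leaves exactly the noise-free part of \<open>G ** M11 ** G\<close>.\<close>
  have "K + transpose K = G ** Q ** A ** G + G ** transpose A ** Q ** G"
    by (simp add: K_def matrix_algebra G Q)
  then have "G ** M11 ** G = K + transpose K + G ** E11 ** G"
    by (simp add: M11_def matrix_algebra)
  then have R: "R = (- 1/2) *\<^sub>R (K + transpose K + G ** E11 ** G)"
    by (simp add: R_def)
  have "J - R - (1/2) *\<^sub>R (G ** E11 ** G) = K"
    by (simp add: J_def R vec_eq_iff field_simps)
  moreover have "K ** Q = A"
  proof -
    have "G ** transpose A ** Q ** G ** Q = G ** transpose A ** (Q ** G ** Q)"
      by (simp add: matrix_mul_assoc)
    then show ?thesis
      by (simp add: K_def matrix_mult_diff_left AGQ QGQ)
  qed
  ultimately have drift: "(J - R - (1/2) *\<^sub>R (\<Sum>j=1..k. transpose (\<AA>' j) ** Q ** \<AA>' j)) ** Q = A"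
    unfolding E11' by simp
  \<comment> \<open>Since \<open>P\<close> is minus one half of \<open>G ** M12\<close>, the sum
    \<open>F + P\<close> is \<open>B - G ** M12\<close>, and the \<open>E12\<close> inside
    \<open>M12\<close> cancels the noise term of the readout.\<close>
  have "F + P + G ** E12 = B - G ** Q ** B + G ** transpose C"
  proof -
    have "F + P = B - G ** M12"
      by (simp add: F_def P_def vec_eq_iff)
    then show ?thesis
      by (simp add: M12_def matrix_algebra)
  qed
  \<comment> \<open>The two \<open>B\<close> terms cancel by \<open>QGQ\<close>, and the last term
    is \<open>C\<close> by absorption.\<close>
  then have "transpose (F + P + G ** E12) ** Q =
      transpose B ** Q - transpose B ** (Q ** G ** Q) + C ** G ** Q"
    by (simp add: matrix_algebra G Q)
  then have readout: "transpose (F + P + (\<Sum>j=1..k. transpose (\<AA>' j) ** Q ** \<BB> j)) ** Q = C"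
    unfolding E12' by (simp add: QGQ CGQ)
  have readout': "S + N + (1/2) *\<^sub>R (\<Sum>j=1..k. transpose (\<BB> j) ** Q ** \<BB> j) = D"
    unfolding E22_def[symmetric] by (simp add: S_def N_def M22_def vec_eq_iff field_simps)
  have "F - P = B"
    by (simp add: F_def)
  with assms(1) J RS N psd drift readout readout' show ?thesis
    unfolding slti_phs_def
    by (intro conjI exI[of _ J] exI[of _ R] exI[of _ \<AA>'] exI[of _ F] exI[of _ P] exI[of _ \<BB>]
        exI[of _ S] exI[of _ N]) (simp_all add: sltis_def \<AA>'_def \<AA>GQ)
qed

end
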